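(* Let $L$ be a residuated lattice, let $n\geq 1$ be an integer, and let $F_1$ and $F_2$ be filters of $L$ with $F_1\subseteq F_2$. If $F_1$ is an $n$-fold implicative filter of $L$, then $F_2$ is an $n$-fold implicative filter of $L$.
   Context: A residuated lattice is an algebra $(L,\wedge,\vee,\otimes,\rightarrow,0,1)$ such that $(L,\wedge,\vee,0,1)$ is a bounded lattice, $(L,\otimes,1)$ is a commutative monoid, and $x\otimes y\leq z$ iff $x\leq y\rightarrow z$. A filter of $L$ is a nonempty subset $F$ closed under $\otimes$ and upward closed (if $x\leq y$ and $x\in F$ then $y\in F$). For $x\in L$, $x^n=x\otimes\cdots\otimes x$ ($n$ factors). A subset $F\subseteq L$ is an $n$-fold implicative filter if $1\in F$ and for all $x,y,z\in L$: if $x^n\rightarrow(y\rightarrow z)\in F$ and $x^n\rightarrow y\in F$, then $x^n\rightarrow z\in F$. *)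

theory Defs
  imports Main
begin

text \<open>
  The monoid operation \<open>\<otimes>\<close> is written \<open>*\<close>, so that \<open>x ^ n\<close> is its \<open>n\<close>-fold power. The lattice
  constants \<open>0\<close> and \<open>1\<close> are \<open>bot\<close> and \<open>top\<close>; the monoid unit \<open>1\<close> is the same element as the
  greatest element, which is the content of \<open>one_eq_top\<close>.
\<close>

class residuated_lattice = bounded_lattice + comm_monoid_mult +
  fixes residuum :: "'a \<Rightarrow> 'a \<Rightarrow> 'a"  (infixr "\<rightarrow>\<^sub>r" 60)
  assumes one_eq_top: "1 = top"
    and residuation: "x * y \<le> z \<longleftrightarrow> x \<le> y \<rightarrow>\<^sub>r z"

definition rl_filter :: "'a::residuated_lattice set \<Rightarrow> bool" where
  "rl_filter F \<longleftrightarrow>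
    F \<noteq> {} \<and>
    (\<forall>x\<in>F. \<forall>y\<in>F. x * y \<in> F) \<and>
    (\<forall>x y. x \<le> y \<longrightarrow> x \<in> F \<longrightarrow> y \<in> F)"

definition n_fold_implicative_filter :: "nat \<Rightarrow> 'a::residuated_lattice set \<Rightarrow> bool" where
  "n_fold_implicative_filter n F \<longleftrightarrow>
    1 \<in> F \<and>
    (\<forall>x y z. x ^ n \<rightarrow>\<^sub>r (y \<rightarrow>\<^sub>r z) \<in> F \<longrightarrow> x ^ n \<rightarrow>\<^sub>r y \<in> F \<longrightarrow> x ^ n \<rightarrow>\<^sub>r z \<in> F)"

end

theory Submission
  imports Defs
begin

text \<open>
  Put \<open>p = x ^ n\<close>. Taking \<open>y = p\<close> and \<open>z = p * p\<close> in the implicative property shows that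
  \<open>p \<rightarrow> p * p\<close> belongs to the smaller filter, hence to the larger one. Conversely, a filter
  containing all these elements is implicative, because
  \<open>(p \<rightarrow> p * p) * (p \<rightarrow> (y \<rightarrow> z)) * (p \<rightarrow> y) \<le> p \<rightarrow> z\<close>.
\<close>

text \<open>Monotonicity is not a class axiom; it comes from the adjunction, whose unit is
  \<open>b \<le> c \<rightarrow>\<^sub>r b * c\<close>.\<close>

lemma residuated_mult_left_mono:
  fixes a b c :: "'a::residuated_lattice"
  assumes "a \<le> b"
  shows "a * c \<le> b * c"
proof -
  have "b \<le> c \<rightarrow>\<^sub>r b * c"
    by (simp flip: residuation)
  with assms have "a \<le> c \<rightarrow>\<^sub>r b * c"
    by (rule order_trans)
  then show ?thesis
    by (simp add: residuation)
qed

lemma residuated_mult_mono: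
  fixes a b c d :: "'a::residuated_lattice"
  assumes "a \<le> b" and "c \<le> d"
  shows "a * c \<le> b * d"
  using residuated_mult_left_mono[OF assms(1), of c] residuated_mult_left_mono[OF assms(2), of b]
  by (simp add: mult.commute)

lemma residuum_mult_le: "(a \<rightarrow>\<^sub>r b) * a \<le> (b::'a::residuated_lattice)"
  by (simp add: residuation)

lemma residuum_eq_one:
  fixes a b :: "'a::residuated_lattice"
  assumes "a \<le> b"
  shows "a \<rightarrow>\<^sub>r b = 1"
proof -
  have "1 \<le> a \<rightarrow>\<^sub>r b"
    using assms by (simp flip: residuation)
  then show ?thesis
    by (simp add: one_eq_top top_unique)
qed

lemma rl_filter_one:
  assumes "rl_filter F"
  shows "1 \<in> F"
proof -
  obtain a where "a \<in> F"
    using assms by (auto simp: rl_filter_def)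
  moreover have "a \<le> 1"
    by (simp add: one_eq_top)
  ultimately show ?thesis
    using assms unfolding rl_filter_def by blast
qed

text \<open>After residuation a single \<open>p\<close> stands on the left. The first factor
  duplicates it, and the other two factors consume one copy each, leaving
  \<open>y \<rightarrow>\<^sub>r z\<close> and \<open>y\<close>.\<close>

lemma residuum_contraction:
  fixes p y z :: "'a::residuated_lattice"
  shows "(p \<rightarrow>\<^sub>r p * p) * (p \<rightarrow>\<^sub>r (y \<rightarrow>\<^sub>r z)) * (p \<rightarrow>\<^sub>r y) \<le> p \<rightarrow>\<^sub>r z"
proof -
  let ?e = "p \<rightarrow>\<^sub>r p * p" and ?a = "p \<rightarrow>\<^sub>r (y \<rightarrow>\<^sub>r z)" and ?b = "p \<rightarrow>\<^sub>r y"
  have "?e * ?a * ?b * p = (?e * p) * (?a * ?b)"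
    by (simp add: ac_simps)
  also have "\<dots> \<le> (p * p) * (?a * ?b)"
    by (intro residuated_mult_left_mono residuum_mult_le)
  also have "\<dots> = (?a * p) * (?b * p)"
    by (simp add: ac_simps)
  also have "\<dots> \<le> (y \<rightarrow>\<^sub>r z) * y"
    by (intro residuated_mult_mono residuum_mult_le)
  also have "\<dots> \<le> z"
    by (rule residuum_mult_le)
  finally show ?thesis
    by (simp add: residuation)
qed

text \<open>The definition is an implication between memberships, so it is not visibly monotone in
  \<open>F\<close>; the right-hand side, pure membership of fixed elements, is.\<close>

lemma n_fold_implicative_filter_iff:
  assumes "rl_filter F"
  shows "n_fold_implicative_filter n F \<longleftrightarrow> (\<forall>x. x ^ n \<rightarrow>\<^sub>r x ^ n * x ^ n \<in> F)"
proof
  assume F: "n_fold_implicative_filter n F"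
  show "\<forall>x. x ^ n \<rightarrow>\<^sub>r x ^ n * x ^ n \<in> F"
  proof
    fix x :: 'a
    \<comment> \<open>Both premises of the implicative property are \<open>1\<close>, which lies in
      \<open>F\<close>.\<close>
    have "x ^ n \<rightarrow>\<^sub>r (x ^ n \<rightarrow>\<^sub>r x ^ n * x ^ n) = 1"
      by (rule residuum_eq_one) (simp flip: residuation)
    moreover have "x ^ n \<rightarrow>\<^sub>r x ^ n = 1"
      by (simp add: residuum_eq_one)
    ultimately show "x ^ n \<rightarrow>\<^sub>r x ^ n * x ^ n \<in> F"
      using F unfolding n_fold_implicative_filter_def by metis
  qed
next
  assume "\<forall>x. x ^ n \<rightarrow>\<^sub>r x ^ n * x ^ n \<in> F"
  \<comment> \<open>The product in \<open>residuum_contraction\<close> lies in \<open>F\<close> by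
    closure under \<open>*\<close>, so its upper bound does too.\<close>
  then show "n_fold_implicative_filter n F"
    using assms rl_filter_one[OF assms] residuum_contraction
    unfolding n_fold_implicative_filter_def rl_filter_def by metis
qed

theorem theorem4p13:
  fixes n :: nat and F\<^sub>1 F\<^sub>2 :: "'a::residuated_lattice set"
  assumes "n \<ge> 1"
    and "rl_filter F\<^sub>1"
    and "rl_filter F\<^sub>2"
    and "F\<^sub>1 \<subseteq> F\<^sub>2"
    and "n_fold_implicative_filter n F\<^sub>1"
  shows "n_fold_implicative_filter n F\<^sub>2"
  using assms by (auto simp: n_fold_implicative_filter_iff)

end
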